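(* Let the iteration sequence of the two-stage optimization be $\cdots\mapsto\{q_{t-1},\theta_t\}\mapsto\{q_t,\theta_{t+1}\}\mapsto\cdots\mapsto\{q_*,\theta_*\}$, with converged equilibrium $(q_*,\theta_* )$. Assume that the implicit function $h:\Theta\to\mathcal{Q}_\alpha$ is $\beta_h$-Lipschitz continuous with respect to $\theta\in\Theta$ and that $\nabla_\theta\mathcal{F}(q,\theta)$ is $\beta_q$-Lipschitz continuous with respect to $q\in\mathcal{Q}_\alpha$. Suppose that $$\|I-\lambda\nabla_{\theta\theta}^2\mathcal{F}(q_*,\theta_* )\|_2<1-\lambda\beta_q\beta_h.$$ Then $$\lim_{t\to\infty}\frac{\|\theta_{t+1}-\theta_*\|_2}{\|\theta_t-\theta_*\|_2}\le 1,$$ and the iteration converges with the rate $\|I-\lambda\nabla_{\theta\theta}^2\mathcal{F}(q_*,\theta_* )\|_2+\lambda\beta_q\beta_h$ when $t$ approaches infinity.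
   Context: $p(\tau)$ is the task distribution (density) on the task set $\mathcal{T}$, $\Theta$ (a subset of a Euclidean space) is the model parameter space, $\alpha\in[0,1)$. Each task $\tau$ has a support set $\mathfrak{D}_\tau^S$ and query set $\mathfrak{D}_\tau^Q$, and $\ell(\mathfrak{D}_\tau^Q,\mathfrak{D}_\tau^S;\theta)\in\mathbb{R}^+$ is the meta risk. The uncertainty set is $\mathcal{Q}_{\alpha}:=\{q(\tau)\mid\mathcal{T}_{q}\subseteq\mathcal{T},\int_{\tau\in\mathcal{T}_{q}}p(\tau)d\tau=1-\alpha\}$, where $q(\tau)$ is the normalized probability density over the task subspace $\mathcal{T}_q$ (i.e. $q=p/(1-\alpha)$ on $\mathcal{T}_q$ and $0$ elsewhere), with distance $d_{\mathcal{Q}_\alpha}(q_1,q_2)=\int_{\mathcal{T}}|q_1(\tau)-q_2(\tau)|d\tau$. The objective is $\mathcal{F}(q,\theta):=\mathbb{E}_{q(\tau)}[\ell(\mathfrak{D}_\tau^Q,\mathfrak{D}_\tau^S;\theta)]$, and $h(\theta)=\arg\max_{\bar q\in\mathcal{Q}_\alpha}\mathcal{F}(\bar q,\theta)$. Iteration: the leader plays $q_t=h(\theta_t)$ and then the follower performs a gradient descent step with learning rate $\lambda>0$, $\theta_{t+1}=\theta_t-\lambda\nabla_\theta\mathcal{F}(q_t,\theta_t)$. $\nabla^2_{\theta\theta}\mathcal{F}$ is the Hessian in $\theta$; $I$ is the identity matrix; $\|\cdot\|_2$ is the Euclidean norm on vectors and the spectral norm on matrices. $(q_*,\theta_* )$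 is the limit of the iteration sequence, a local Stackelberg equilibrium: in a neighborhood $\mathcal{Q}'_\alpha\times\Theta'$, for all $q\in\mathcal{Q}'_\alpha$, $\inf_{\theta\in\mathcal{S}_{\Theta'}(q_* )}\mathcal{F}(q_*,\theta)\ge\inf_{\theta\in\mathcal{S}_{\Theta'}(q)}\mathcal{F}(q,\theta)$, where $\mathcal{S}_{\Theta'}(q):=\{\bar\theta\in\Theta'\mid\mathcal{F}(q,\bar\theta)\le\mathcal{F}(q,\theta)\ \forall\theta\in\Theta'\}$. "Converges with the rate $\rho$" means $\lim_{t\to\infty}\|\theta_{t+1}-\theta_*\|_2/\|\theta_t-\theta_*\|_2\le\rho$.
   Formalization: The limit of the error ratios need not exist under these hypotheses (they can oscillate, or become 0/0), so both limit bounds are proved for the limit superior, with the ratio taken as 0 where θ_t = θ_*; they give the stated bounds whenever the limit exists. *)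

theory Defs
  imports "HOL-Analysis.Analysis"
begin

text \<open>
  The task set is the space of a measure \<open>M\<close>, which plays the role of the reference
  measure \<open>d\<tau>\<close>; task distributions are real-valued densities with respect to \<open>M\<close>.
\<close>

definition prob_density :: "'task measure \<Rightarrow> ('task \<Rightarrow> real) \<Rightarrow> bool" where
  "prob_density M p \<longleftrightarrow>
     (\<forall>\<tau>\<in>space M. 0 \<le> p \<tau>) \<and> has_bochner_integral M p 1"

definition uncertainty_set ::
    "'task measure \<Rightarrow> ('task \<Rightarrow> real) \<Rightarrow> real \<Rightarrow> ('task \<Rightarrow> real) set" where
  "uncertainty_set M p \<alpha> =
     {q. \<exists>Tq\<in>sets M. (LINT \<tau>:Tq|M. p \<tau>) = 1 - \<alpha> \<and>
           q = (\<lambda>\<tau>. if \<tau> \<in> Tq then p \<tau> / (1 - \<alpha>) else 0)}"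

definition density_dist ::
    "'task measure \<Rightarrow> ('task \<Rightarrow> real) \<Rightarrow> ('task \<Rightarrow> real) \<Rightarrow> real" where
  "density_dist M q1 q2 = (LINT \<tau>|M. \<bar>q1 \<tau> - q2 \<tau>\<bar>)"

text \<open>
  \<open>DQ\<close> and \<open>DS\<close> map a task to its query and support set. The risk \<open>l\<close> is a function on
  all of \<open>\<real>\<^sup>n\<close>, and the derivatives below are taken in \<open>\<real>\<^sup>n\<close>, at points of the parameter
  space \<open>\<Theta>\<close>. For open \<open>\<Theta>\<close> they depend only on the values of \<open>l\<close> on \<open>\<Theta>\<close>.
\<close>

definition meta_objective ::
    "'task measure \<Rightarrow> ('task \<Rightarrow> 'qry) \<Rightarrow> ('task \<Rightarrow> 'sup)
      \<Rightarrow> ('qry \<Rightarrow> 'sup \<Rightarrow> real ^ 'n \<Rightarrow> real)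
      \<Rightarrow> ('task \<Rightarrow> real) \<Rightarrow> real ^ 'n \<Rightarrow> real" where
  "meta_objective M DQ DS l q \<theta> = (LINT \<tau>|M. q \<tau> * l (DQ \<tau>) (DS \<tau>) \<theta>)"

definition gradient :: "(real ^ 'n \<Rightarrow> real) \<Rightarrow> real ^ 'n \<Rightarrow> real ^ 'n" where
  "gradient f x = (THE D. GDERIV f x :> D)"

definition hessian :: "(real ^ 'n \<Rightarrow> real) \<Rightarrow> real ^ 'n \<Rightarrow> real ^ 'n ^ 'n" where
  "hessian f x = jacobian (gradient f) (at x)"

definition twice_differentiable_at :: "(real ^ 'n \<Rightarrow> real) \<Rightarrow> real ^ 'n \<Rightarrow> bool" where
  "twice_differentiable_at f x \<longleftrightarrow>
     (\<forall>\<^sub>F y in nhds x. f differentiable (at y)) \<and> gradient f differentiable (at x)"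

definition spectral_norm :: "real ^ 'n ^ 'm \<Rightarrow> real" where
  "spectral_norm A = onorm ((*v) A)"

definition follower_optima ::
    "('q \<Rightarrow> 'a \<Rightarrow> real) \<Rightarrow> 'a set \<Rightarrow> 'q \<Rightarrow> 'a set" where
  "follower_optima F \<Theta>' q = {\<theta>\<in>\<Theta>'. \<forall>\<theta>'\<in>\<Theta>'. F q \<theta> \<le> F q \<theta>'}"

text \<open>
  The neighbourhoods are relative to \<open>Q\<close> (with the distance \<open>d\<close>) and to \<open>\<Theta>\<close>. The infima
  are taken in the extended reals, so that the infimum over an empty set of follower
  optima is \<open>\<infinity>\<close>.
\<close>

definition local_stackelberg_equilibrium ::
    "('q \<Rightarrow> 'q \<Rightarrow> real) \<Rightarrow> ('q \<Rightarrow> 'a::metric_space \<Rightarrow> real) \<Rightarrow> 'q set \<Rightarrow> 'a set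
      \<Rightarrow> 'q \<Rightarrow> 'a \<Rightarrow> bool" where
  "local_stackelberg_equilibrium d F Q \<Theta> qs \<theta>s \<longleftrightarrow> qs \<in> Q \<and> \<theta>s \<in> \<Theta> \<and>
     (\<exists>Q' \<Theta>'. Q' \<subseteq> Q \<and> (\<exists>\<epsilon>>0. {q\<in>Q. d qs q < \<epsilon>} \<subseteq> Q') \<and>
        \<Theta>' \<subseteq> \<Theta> \<and> (\<exists>\<epsilon>>0. ball \<theta>s \<epsilon> \<inter> \<Theta> \<subseteq> \<Theta>') \<and>
        (\<forall>q\<in>Q'. (INF \<theta>\<in>follower_optima F \<Theta>' qs. ereal (F qs \<theta>)) \<ge>
                 (INF \<theta>\<in>follower_optima F \<Theta>' q. ereal (F q \<theta>))))"

text \<open>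
  The successive error ratios of a convergent sequence need not converge, so the limit of
  the ratios is taken as an upper limit, which equals the limit whenever that exists.
  If \<open>x t = L\<close>, division by zero makes the ratio \<open>0\<close>.
\<close>

definition error_ratio :: "(nat \<Rightarrow> 'a::real_normed_vector) \<Rightarrow> 'a \<Rightarrow> nat \<Rightarrow> real" where
  "error_ratio x L t = norm (x (Suc t) - L) / norm (x t - L)"

definition converges_with_rate ::
    "(nat \<Rightarrow> 'a::real_normed_vector) \<Rightarrow> 'a \<Rightarrow> real \<Rightarrow> bool" where
  "converges_with_rate x L \<rho> \<longleftrightarrow>
     x \<longlonglongrightarrow> L \<and> limsup (\<lambda>t. ereal (error_ratio x L t)) \<le> ereal \<rho>"

end

theory Submission
  imports Defs
begin

text \<open>
  Since \<open>q t = h (\<theta> t)\<close> is \<open>\<beta>h\<close>-Lipschitz in \<open>\<theta> t\<close> and tends to \<open>qs\<close>, its distance to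
  \<open>qs\<close> is at most \<open>\<beta>h * norm (\<theta> t - \<theta>s)\<close>. So the descent step is, up to an error of
  \<open>lr * \<beta>q * \<beta>h * norm (\<theta> t - \<theta>s)\<close>, an iteration of the map
  \<open>u \<mapsto> u - lr *\<^sub>R gradient (F qs) u\<close>, which has derivative \<open>mat 1 - lr *\<^sub>R hessian (F qs) \<theta>s\<close>
  at \<open>\<theta>s\<close>. That error tends to \<open>0\<close>, so passing to the limit in the iteration shows that
  \<open>\<theta>s\<close> is a fixed point of the map, and the derivative there gives the rate.
\<close>

text \<open>The new error splits into the perturbation \<open>x (Suc t) - G (x t)\<close>, the
  linearisation remainder of \<open>G\<close> at \<open>L\<close>, and the linear part
  \<open>A (x t - L)\<close>. Relative to \<open>norm (x t - L)\<close> these are at most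
  \<open>c\<close>, eventually an arbitrarily small \<open>e\<close>, and
  \<open>onorm A\<close>.\<close>

lemma limsup_error_ratio_perturbed_fixed_point_iteration:
  fixes G :: "'a::real_normed_vector \<Rightarrow> 'a"
  assumes G: "(G has_derivative A) (at L)" and fp: "G L = L"
    and x: "x \<longlonglongrightarrow> L" and c: "0 \<le> c"
    and step: "\<And>t. norm (x (Suc t) - G (x t)) \<le> c * norm (x t - L)"
  shows "limsup (\<lambda>t. ereal (error_ratio x L t)) \<le> ereal (onorm A + c)"
proof (rule ereal_le_epsilon2)
  fix e :: real
  assume e: "0 < e"
  have A: "bounded_linear A"
    and ev: "\<And>e. 0 < e \<Longrightarrow> \<exists>d>0. \<forall>y. norm (y - L) < d \<longrightarrow>
                 norm (G y - G L - A (y - L)) \<le> e * norm (y - L)"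
    using G unfolding has_derivative_at_alt by auto
  obtain d where d: "0 < d"
    and Gd: "\<And>y. norm (y - L) < d \<Longrightarrow> norm (G y - L - A (y - L)) \<le> e * norm (y - L)"
    using ev[OF e] fp by auto
  have "\<forall>\<^sub>F t in sequentially. norm (x t - L) < d"
    using tendstoD[OF x d] by (simp add: dist_norm)
  then have "\<forall>\<^sub>F t in sequentially. error_ratio x L t \<le> onorm A + c + e"
  proof eventually_elim
    case (elim t)
    have "x (Suc t) - L = (x (Suc t) - G (x t)) + (G (x t) - L - A (x t - L)) + A (x t - L)"
      by simp
    also have "norm \<dots> \<le> c * norm (x t - L) + e * norm (x t - L) + onorm A * norm (x t - L)"
      by (intro norm_triangle_mono step Gd elim onorm A)
    finally have "norm (x (Suc t) - L) \<le> (onorm A + c + e) * norm (x t - L)"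
      by (simp add: algebra_simps)
    \<comment> \<open>If \<open>x t = L\<close>, the ratio is 0 by the convention on division by
      zero, and the bound holds because \<open>onorm A + c + e\<close> is nonnegative.\<close>
    then show ?case
      using onorm_pos_le[OF A] c e
      by (cases "x t = L") (simp_all add: error_ratio_def divide_le_eq)
  qed
  then have "limsup (\<lambda>t. ereal (error_ratio x L t)) \<le> ereal (onorm A + c + e)"
    by (intro Limsup_bounded) simp
  then show "limsup (\<lambda>t. ereal (error_ratio x L t)) \<le> ereal (onorm A + c) + ereal e"
    by simp
qed

text \<open>Supplies the integrability required for the triangle inequality below: a member of the
  set is \<open>p\<close> cut off to a measurable set and rescaled by a constant.\<close>

lemma integrable_uncertainty_set:
  assumes "integrable M p" and "q \<in> uncertainty_set M p \<alpha>"
  shows "integrable M q"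
proof -
  obtain T where T: "T \<in> sets M" and q: "q = (\<lambda>\<tau>. if \<tau> \<in> T then p \<tau> / (1 - \<alpha>) else 0)"
    using assms(2) by (auto simp: uncertainty_set_def)
  have "integrable M (\<lambda>\<tau>. (indicator T \<tau> *\<^sub>R p \<tau>) / (1 - \<alpha>))"
    by (intro integrable_divide integrable_mult_indicator T assms(1))
  also have "(\<lambda>\<tau>. (indicator T \<tau> *\<^sub>R p \<tau>) / (1 - \<alpha>)) = q"
    unfolding q by (auto simp: indicator_def)
  finally show ?thesis .
qed

text \<open>Integrability matters here: the Bochner integral of a non-integrable function is 0, so
  without it the right-hand side could collapse to 0.\<close>

lemma density_dist_triangle:
  assumes "integrable M q1" "integrable M q2" "integrable M q3"
  shows "density_dist M q1 q3 \<le> density_dist M q1 q2 + density_dist M q2 q3"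
proof -
  have "density_dist M q1 q3 \<le> (LINT \<tau>|M. \<bar>q1 \<tau> - q2 \<tau>\<bar> + \<bar>q2 \<tau> - q3 \<tau>\<bar>)"
    unfolding density_dist_def using assms by (intro integral_mono) auto
  also have "\<dots> = density_dist M q1 q2 + density_dist M q2 q3"
    unfolding density_dist_def using assms by (intro Bochner_Integration.integral_add) auto
  finally show ?thesis .
qed

lemma has_derivative_gradient:
  assumes "twice_differentiable_at f x"
  shows "(gradient f has_derivative (*v) (hessian f x)) (at x)"
  using assms jacobian_works unfolding twice_differentiable_at_def hessian_def by blast

theorem theorem4p1:
  fixes M :: "'task measure"
    and p :: "'task \<Rightarrow> real"
    and \<alpha> lr \<beta>h \<beta>q :: real
    and DQ :: "'task \<Rightarrow> 'qry"
    and DS :: "'task \<Rightarrow> 'sup"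
    and l :: "'qry \<Rightarrow> 'sup \<Rightarrow> real ^ 'n \<Rightarrow> real"
    and \<Theta> :: "(real ^ 'n) set"
    and h :: "real ^ 'n \<Rightarrow> 'task \<Rightarrow> real"
    and q :: "nat \<Rightarrow> 'task \<Rightarrow> real"
    and \<theta> :: "nat \<Rightarrow> real ^ 'n"
    and qs :: "'task \<Rightarrow> real"
    and \<theta>s :: "real ^ 'n"
  defines "Q \<equiv> uncertainty_set M p \<alpha>"
    and "d \<equiv> density_dist M"
    and "F \<equiv> meta_objective M DQ DS l"
  assumes "prob_density M p"
    and "0 \<le> \<alpha>" and "\<alpha> < 1" and "lr > 0"
    and "\<And>\<tau> u. \<tau> \<in> space M \<Longrightarrow> u \<in> \<Theta> \<Longrightarrow> 0 \<le> l (DQ \<tau>) (DS \<tau>) u"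
    and "\<And>q' u. q' \<in> Q \<Longrightarrow> u \<in> \<Theta> \<Longrightarrow>
           integrable M (\<lambda>\<tau>. q' \<tau> * l (DQ \<tau>) (DS \<tau>) u)"
    and "\<And>q' u. q' \<in> Q \<Longrightarrow> u \<in> \<Theta> \<Longrightarrow> F q' differentiable (at u)"
    and "twice_differentiable_at (F qs) \<theta>s"
    and "\<And>u. u \<in> \<Theta> \<Longrightarrow> is_arg_max (\<lambda>q'. F q' u) (\<lambda>q'. q' \<in> Q) (h u)"
    and "\<And>t. \<theta> t \<in> \<Theta>"
    and "\<And>t. q t = h (\<theta> t)"
    and "\<And>t. \<theta> (Suc t) = \<theta> t - lr *\<^sub>R gradient (F (q t)) (\<theta> t)"
    and "\<theta> \<longlonglongrightarrow> \<theta>s"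
    and "(\<lambda>t. d (q t) qs) \<longlonglongrightarrow> 0"
    and "local_stackelberg_equilibrium d F Q \<Theta> qs \<theta>s"
    and "0 \<le> \<beta>h"
    and "\<And>u1 u2. u1 \<in> \<Theta> \<Longrightarrow> u2 \<in> \<Theta> \<Longrightarrow>
           d (h u1) (h u2) \<le> \<beta>h * norm (u1 - u2)"
    and "0 \<le> \<beta>q"
    and "\<And>q1 q2 u. q1 \<in> Q \<Longrightarrow> q2 \<in> Q \<Longrightarrow> u \<in> \<Theta> \<Longrightarrow>
           norm (gradient (F q1) u - gradient (F q2) u) \<le> \<beta>q * d q1 q2"
    and "spectral_norm (mat 1 - lr *\<^sub>R hessian (F qs) \<theta>s) < 1 - lr * \<beta>q * \<beta>h"
  shows "limsup (\<lambda>t. ereal (error_ratio \<theta> \<theta>s t)) \<le> 1 \<and>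
         converges_with_rate \<theta> \<theta>s
           (spectral_norm (mat 1 - lr *\<^sub>R hessian (F qs) \<theta>s) + lr * \<beta>q * \<beta>h)"
proof -
  note density = assms(4) and lr = assms(7) and twice = assms(11) and argmax = assms(12)
  note \<theta>_in = assms(13) and q_eq = assms(14) and descent = assms(15) and \<theta>_lim = assms(16)
  note q_lim = assms(17) and equilibrium = assms(18) and \<beta>h = assms(19) and h_lipschitz = assms(20)
  note \<beta>q = assms(21) and gradient_lipschitz = assms(22) and small = assms(23)
  define S where "S = spectral_norm (mat 1 - lr *\<^sub>R hessian (F qs) \<theta>s)"
  define G where "G u = u - lr *\<^sub>R gradient (F qs) u" for u
  have h: "h u \<in> Q" if "u \<in> \<Theta>" for u
    using argmax[OF that] by (simp add: is_arg_max_def)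
  have qs: "qs \<in> Q"
    using equilibrium by (simp add: local_stackelberg_equilibrium_def)
  have integrable: "integrable M q'" if "q' \<in> Q" for q'
  proof (rule integrable_uncertainty_set)
    show "integrable M p"
      using density by (simp add: prob_density_def has_bochner_integral_iff)
    show "q' \<in> uncertainty_set M p \<alpha>"
      using that by (simp add: Q_def)
  qed
  \<comment> \<open>\<open>qs\<close> is not assumed to be a value of \<open>h\<close>, so the
    Lipschitz bound is applied between the times \<open>t\<close> and \<open>s\<close>, the
    remaining distance from \<open>q s\<close> to \<open>qs\<close> is added, and \<open>s\<close>
    tends to infinity with \<open>t\<close> fixed.\<close>
  have dist: "d (q t) qs \<le> \<beta>h * norm (\<theta> t - \<theta>s)" for t
  proof (rule LIMSEQ_le_const)
    show "(\<lambda>s. \<beta>h * norm (\<theta> t - \<theta> s) + d (q s) qs) \<longlonglongrightarrow> \<beta>h * norm (\<theta> t - \<theta>s)"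
      using tendsto_add[OF tendsto_mult_left[OF tendsto_norm[OF tendsto_diff[OF tendsto_const \<theta>_lim]]] q_lim]
      by simp
    have "d (q t) qs \<le> \<beta>h * norm (\<theta> t - \<theta> s) + d (q s) qs" for s
    proof -
      have "d (q t) qs \<le> d (q t) (q s) + d (q s) qs"
        unfolding d_def by (intro density_dist_triangle integrable qs) (simp_all add: q_eq h \<theta>_in)
      also have "d (q t) (q s) \<le> \<beta>h * norm (\<theta> t - \<theta> s)"
        by (simp add: q_eq h_lipschitz \<theta>_in)
      finally show ?thesis by simp
    qed
    then show "\<exists>N. \<forall>s\<ge>N. d (q t) qs \<le> \<beta>h * norm (\<theta> t - \<theta> s) + d (q s) qs" by blast
  qed
  have step: "norm (\<theta> (Suc t) - G (\<theta> t)) \<le> (lr * \<beta>q * \<beta>h) * norm (\<theta> t - \<theta>s)" for t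
  proof -
    \<comment> \<open>The actual step and \<open>G\<close> take the gradient at the same point
      \<open>\<theta> t\<close> and differ only in the density, so Lipschitz continuity in the
      density applies.\<close>
    have "\<theta> (Suc t) - G (\<theta> t) = lr *\<^sub>R (gradient (F qs) (\<theta> t) - gradient (F (q t)) (\<theta> t))"
      by (simp add: G_def descent algebra_simps)
    then have "norm (\<theta> (Suc t) - G (\<theta> t))
        = lr * norm (gradient (F (q t)) (\<theta> t) - gradient (F qs) (\<theta> t))"
      using lr by (simp add: norm_minus_commute)
    also have "\<dots> \<le> lr * (\<beta>q * d (q t) qs)"
      using lr by (intro mult_left_mono gradient_lipschitz qs \<theta>_in) (simp_all add: q_eq h \<theta>_in)
    also have "\<dots> \<le> lr * (\<beta>q * (\<beta>h * norm (\<theta> t - \<theta>s)))"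
      using lr \<beta>q by (intro mult_left_mono dist) simp_all
    finally show ?thesis by (simp add: mult.assoc)
  qed
  have G_deriv: "(G has_derivative (*v) (mat 1 - lr *\<^sub>R hessian (F qs) \<theta>s)) (at \<theta>s)"
  proof -
    \<comment> \<open>The differentiation rules yield the derivative of \<open>G\<close> as a
      function of \<open>v\<close>; this equation identifies it with the matrix whose spectral norm
      is the rate.\<close>
    have "(*v) (mat 1 - lr *\<^sub>R hessian (F qs) \<theta>s) = (\<lambda>v. v - lr *\<^sub>R (hessian (F qs) \<theta>s *v v))"
      by (simp add: fun_eq_iff matrix_vector_mult_diff_rdistrib scaleR_matrix_vector_assoc)
    then show ?thesis
      using has_derivative_diff[OF has_derivative_ident
          has_derivative_scaleR_right[OF has_derivative_gradient[OF twice], of lr]]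
      by (simp add: G_def[abs_def])
  qed
  \<comment> \<open>Since \<open>lr > 0\<close>, this says that the gradient of \<open>F qs\<close>
    vanishes at \<open>\<theta>s\<close>. It is read off from the iteration, using only continuity
    of \<open>G\<close> at the limit.\<close>
  have "G \<theta>s = \<theta>s"
  proof -
    have "(\<lambda>t. G (\<theta> t)) \<longlonglongrightarrow> G \<theta>s"
      using isCont_tendsto_compose[OF has_derivative_continuous[OF G_deriv] \<theta>_lim] .
    moreover have "(\<lambda>t. \<theta> (Suc t) - G (\<theta> t)) \<longlonglongrightarrow> 0"
    proof (rule Lim_null_comparison)
      show "\<forall>\<^sub>F t in sequentially.
          norm (\<theta> (Suc t) - G (\<theta> t)) \<le> (lr * \<beta>q * \<beta>h) * norm (\<theta> t - \<theta>s)"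
        using step by simp
      show "(\<lambda>t. (lr * \<beta>q * \<beta>h) * norm (\<theta> t - \<theta>s)) \<longlonglongrightarrow> 0"
        by (intro tendsto_mult_right_zero tendsto_norm_zero LIM_zero \<theta>_lim)
    qed
    ultimately have "(\<lambda>t. \<theta> (Suc t)) \<longlonglongrightarrow> G \<theta>s"
      by (rule Lim_transform)
    then show ?thesis
      using LIMSEQ_unique LIMSEQ_Suc[OF \<theta>_lim] by blast
  qed
  then have limsup: "limsup (\<lambda>t. ereal (error_ratio \<theta> \<theta>s t)) \<le> ereal (S + lr * \<beta>q * \<beta>h)"
    unfolding S_def spectral_norm_def
    using lr \<beta>q \<beta>h
    by (intro limsup_error_ratio_perturbed_fixed_point_iteration[OF G_deriv _ \<theta>_lim _ step]) simp_all
  \<comment> \<open>The smallness condition says exactly that the rate is below 1.\<close>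
  also have "\<dots> \<le> 1"
    using small by (simp add: S_def)
  finally show ?thesis
    using limsup \<theta>_lim by (simp add: converges_with_rate_def S_def)
qed

end
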